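(* An implicative-ortholattice $X$ is an implicative-orthomodular lattice if and only if, for all $x,y,z\in X$, $\varphi_y x\perp z$ implies $x\perp\varphi_y z$.
   Context: A BE algebra is an algebra $(X,\to,1)$ such that for all $x,y,z\in X$: $x\to x=1$; $x\to 1=1$; $1\to x=x$; $x\to(y\to z)=y\to(x\to z)$. It carries the relation $x\le y$ iff $x\to y=1$. It is bounded if there is $0\in X$ with $0\le x$ for all $x\in X$; then $x^*:=x\to 0$ (so $0=1^*$) and the algebra is written $(X,\to,{}^*,1)$. It is involutive if $x^{**}=x$ for all $x$, and implicative if $(x\to y)\to x=x$ for all $x,y$. An implicative-ortholattice is an implicative involutive (bounded) BE algebra. Put $x\wedge_Q y:=((x^*\to y^* )\to y^* )^*$. An implicative-orthomodular lattice is an implicative-ortholattice with $x\wedge_Q(y\to x)=x$ for all $x,y$. For $a\in X$ the Sasaki projection is $\varphi_a:X\to X$, $\varphi_a x:=x\wedge_Q a$. Orthogonality: $x\perp y$ iff $x^*=x\to y$. *)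

theory Defs
  imports Main
begin

locale be_algebra =
  fixes imp :: "'a \<Rightarrow> 'a \<Rightarrow> 'a" (infixr "\<rightarrow>" 60)
    and one :: "'a" ("\<one>")
  assumes imp_self: "x \<rightarrow> x = \<one>"
    and imp_one: "x \<rightarrow> \<one> = \<one>"
    and one_imp: "\<one> \<rightarrow> x = x"
    and imp_exchange: "x \<rightarrow> (y \<rightarrow> z) = y \<rightarrow> (x \<rightarrow> z)"
begin

definition le :: "'a \<Rightarrow> 'a \<Rightarrow> bool" (infix "\<sqsubseteq>" 50)
  where "x \<sqsubseteq> y \<longleftrightarrow> x \<rightarrow> y = \<one>"

end

text \<open>
  The bottom element is a parameter: the relation of a BE algebra need not be antisymmetric, so
  in general the bottom element (and with it the complement) is not determined by the
  implication.
\<close>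

locale bounded_be_algebra = be_algebra imp one
  for imp :: "'a \<Rightarrow> 'a \<Rightarrow> 'a" (infixr "\<rightarrow>" 60)
    and one :: "'a" ("\<one>") +
  fixes zero :: "'a" ("\<zero>")
  assumes zero_le: "\<zero> \<sqsubseteq> x"
begin

definition compl :: "'a \<Rightarrow> 'a" ("_\<^sup>\<star>" [1000] 999)
  where "x\<^sup>\<star> = x \<rightarrow> \<zero>"

definition meet_Q :: "'a \<Rightarrow> 'a \<Rightarrow> 'a" (infixl "\<and>\<^sub>Q" 70)
  where "x \<and>\<^sub>Q y = ((x\<^sup>\<star> \<rightarrow> y\<^sup>\<star>) \<rightarrow> y\<^sup>\<star>)\<^sup>\<star>"

definition sasaki :: "'a \<Rightarrow> 'a \<Rightarrow> 'a"
  where "sasaki a x = x \<and>\<^sub>Q a"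

definition orthogonal :: "'a \<Rightarrow> 'a \<Rightarrow> bool" (infix "\<bottom>" 50)
  where "x \<bottom> y \<longleftrightarrow> x\<^sup>\<star> = x \<rightarrow> y"

end

locale implicative_ortholattice = bounded_be_algebra imp one zero
  for imp :: "'a \<Rightarrow> 'a \<Rightarrow> 'a" (infixr "\<rightarrow>" 60)
    and one :: "'a" ("\<one>")
    and zero :: "'a" ("\<zero>") +
  assumes involutive: "(x\<^sup>\<star>)\<^sup>\<star> = x"
    and implicative: "(x \<rightarrow> y) \<rightarrow> x = x"

locale implicative_orthomodular_lattice = implicative_ortholattice imp one zero
  for imp :: "'a \<Rightarrow> 'a \<Rightarrow> 'a" (infixr "\<rightarrow>" 60)
    and one :: "'a" ("\<one>")
    and zero :: "'a" ("\<zero>") +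
  assumes orthomodular: "x \<and>\<^sub>Q (y \<rightarrow> x) = x"

end

theory Submission imports Defs begin

text \<open>
  An implicative-ortholattice is an ortholattice in disguise: with
  \<open>x \<squnion> y = x\<^sup>\<star> \<rightarrow> y\<close> the BE axioms give an associative, commutative and idempotent join, the
  implicative law is absorption, and \<open>\<^sup>\<star>\<close> is an orthocomplementation. The lattice order
  \<open>\<preceq>\<close> is in general strictly smaller than \<open>\<sqsubseteq>\<close>, since \<open>x \<sqsubseteq> y\<close> only says
  \<open>x\<^sup>\<star> \<squnion> y = \<one>\<close>; but orthogonality is about \<open>\<preceq>\<close>: \<open>x \<bottom> y\<close> iff \<open>x \<preceq> y\<^sup>\<star>\<close>. The Sasaki
  projection is the familiar \<open>\<phi>\<^sub>a x = (x \<squnion> a\<^sup>\<star>) \<sqinter> a\<close>, and the orthomodular identity says that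
  \<open>\<phi>\<^sub>y x = x\<close> whenever \<open>x \<preceq> y\<close>.

  The equivalence is then Foulis' argument that Sasaki projections are self-adjoint. Under
  orthomodularity \<open>\<phi>\<^sub>y x \<squnion> y\<^sup>\<star> = x \<squnion> y\<^sup>\<star>\<close> (lemma \<open>sasaki_join_compl\<close>). If \<open>\<phi>\<^sub>y x \<preceq> z\<^sup>\<star>\<close>,
  then \<open>\<phi>\<^sub>y x \<preceq> z\<^sup>\<star> \<sqinter> y\<close>, and joining with \<open>y\<^sup>\<star>\<close> gives
  \<open>x \<preceq> x \<squnion> y\<^sup>\<star> \<preceq> (z\<^sup>\<star> \<sqinter> y) \<squnion> y\<^sup>\<star> = (\<phi>\<^sub>y z)\<^sup>\<star>\<close>. Conversely, for \<open>x \<preceq> y\<close> one has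
  \<open>\<phi>\<^sub>y (x\<^sup>\<star>) = x\<^sup>\<star> \<sqinter> y \<preceq> x\<^sup>\<star>\<close>, so \<open>\<phi>\<^sub>y (x\<^sup>\<star>) \<bottom> x\<close>; moving \<open>\<phi>\<^sub>y\<close> across gives
  \<open>x\<^sup>\<star> \<bottom> \<phi>\<^sub>y x\<close>, that is \<open>\<phi>\<^sub>y x \<preceq> x\<close>, which is the nontrivial half of \<open>\<phi>\<^sub>y x = x\<close>.
\<close>

context implicative_ortholattice
begin

definition join :: "'a \<Rightarrow> 'a \<Rightarrow> 'a" (infixl "\<squnion>" 65)
  where "x \<squnion> y = x\<^sup>\<star> \<rightarrow> y"

definition meet :: "'a \<Rightarrow> 'a \<Rightarrow> 'a" (infixl "\<sqinter>" 70)
  where "x \<sqinter> y = (x\<^sup>\<star> \<squnion> y\<^sup>\<star>)\<^sup>\<star>"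

definition lattice_le :: "'a \<Rightarrow> 'a \<Rightarrow> bool" (infix "\<preceq>" 50)
  where "x \<preceq> y \<longleftrightarrow> x \<squnion> y = y"

definition lattice_less :: "'a \<Rightarrow> 'a \<Rightarrow> bool" (infix "\<prec>" 50)
  where "x \<prec> y \<longleftrightarrow> x \<preceq> y \<and> \<not> y \<preceq> x"

lemma imp_eq_join: "x \<rightarrow> y = x\<^sup>\<star> \<squnion> y"
  by (simp add: join_def involutive)

text \<open>Exchange turns \<open>x\<^sup>\<star> \<rightarrow> (y\<^sup>\<star> \<rightarrow> \<zero>)\<close> into \<open>y\<^sup>\<star> \<rightarrow> (x\<^sup>\<star> \<rightarrow> \<zero>)\<close>.\<close>

lemma join_commute: "x \<squnion> y = y \<squnion> x"
proof -
  have "x\<^sup>\<star> \<rightarrow> (y\<^sup>\<star>)\<^sup>\<star> = y\<^sup>\<star> \<rightarrow> (x\<^sup>\<star>)\<^sup>\<star>"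
    unfolding compl_def[of "y\<^sup>\<star>"] compl_def[of "x\<^sup>\<star>"] by (rule imp_exchange)
  then show ?thesis by (simp add: join_def involutive)
qed

lemma join_left_commute: "x \<squnion> (y \<squnion> z) = y \<squnion> (x \<squnion> z)"
  unfolding join_def by (rule imp_exchange)

lemma join_assoc: "(x \<squnion> y) \<squnion> z = x \<squnion> (y \<squnion> z)"
  by (metis join_commute join_left_commute)

text \<open>The instance \<open>(x \<rightarrow> \<zero>) \<rightarrow> x = x\<close> of the implicative law.\<close>

lemma join_idem: "x \<squnion> x = x"
  using implicative[of x \<zero>] by (simp add: join_def compl_def)

text \<open>Absorption is the implicative law with \<open>x\<^sup>\<star>\<close> in place of \<open>x\<close>.\<close>

lemma meet_join_absorb: "x \<sqinter> (x \<squnion> y) = x"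
proof -
  have "(x \<squnion> y)\<^sup>\<star> \<squnion> x\<^sup>\<star> = x\<^sup>\<star>"
    using implicative[of "x\<^sup>\<star>" y] by (simp add: join_def involutive)
  then show ?thesis by (simp add: meet_def join_commute involutive)
qed

lemma compl_join: "(x \<squnion> y)\<^sup>\<star> = x\<^sup>\<star> \<sqinter> y\<^sup>\<star>"
  by (simp add: meet_def involutive)

lemma compl_meet: "(x \<sqinter> y)\<^sup>\<star> = x\<^sup>\<star> \<squnion> y\<^sup>\<star>"
  by (simp add: meet_def involutive)

lemma join_meet_absorb: "x \<squnion> (x \<sqinter> y) = x"
  by (metis compl_join compl_meet meet_join_absorb involutive)

text \<open>Complementation reverses the order: this is where absorption links join and meet.\<close>

lemma compl_antimono: "x \<preceq> y \<Longrightarrow> y\<^sup>\<star> \<preceq> x\<^sup>\<star>"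
  unfolding lattice_le_def
  by (metis compl_meet join_commute meet_join_absorb)

lemma compl_le_compl_iff: "x\<^sup>\<star> \<preceq> y\<^sup>\<star> \<longleftrightarrow> y \<preceq> x"
  by (metis compl_antimono involutive)

lemma join_least: "x \<preceq> z \<Longrightarrow> y \<preceq> z \<Longrightarrow> x \<squnion> y \<preceq> z"
  by (simp add: lattice_le_def join_assoc)

lemma meet_lower: "x \<sqinter> y \<preceq> x"
  by (metis join_commute join_meet_absorb lattice_le_def)

lemma meet_commute: "x \<sqinter> y = y \<sqinter> x"
  by (simp add: meet_def join_commute)

sublocale ortho: lattice meet lattice_le lattice_less join
proof unfold_locales
  fix x y z
  show "x \<prec> y \<longleftrightarrow> x \<preceq> y \<and> \<not> y \<preceq> x" by (rule lattice_less_def)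
  show "x \<preceq> x" by (simp add: lattice_le_def join_idem)
  show "x \<preceq> z" if "x \<preceq> y" "y \<preceq> z" using that by (metis lattice_le_def join_assoc)
  show "x = y" if "x \<preceq> y" "y \<preceq> x" using that by (metis lattice_le_def join_commute)
  show "x \<sqinter> y \<preceq> x" by (rule meet_lower)
  show "x \<sqinter> y \<preceq> y" using meet_lower[of y x] by (simp add: meet_commute)
  show "x \<preceq> y \<sqinter> z" if "x \<preceq> y" "x \<preceq> z"
  proof -
    have "y\<^sup>\<star> \<squnion> z\<^sup>\<star> \<preceq> x\<^sup>\<star>" using that by (intro join_least compl_antimono)
    then show ?thesis by (metis compl_antimono involutive meet_def)
  qed
  show "x \<preceq> x \<squnion> y" by (simp add: lattice_le_def join_assoc[symmetric] join_idem)
  show "y \<preceq> x \<squnion> y" by (metis lattice_le_def join_left_commute join_idem)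
  show "y \<squnion> z \<preceq> x" if "y \<preceq> x" "z \<preceq> x" using that by (rule join_least)
qed

text \<open>
  The definition \<open>x\<^sup>\<star> = x \<rightarrow> y\<close> reads \<open>x\<^sup>\<star> = x\<^sup>\<star> \<squnion> y\<close>, that is \<open>y \<preceq> x\<^sup>\<star>\<close>; complementing gives
  the symmetric form.
\<close>

lemma orthogonal_iff: "x \<bottom> y \<longleftrightarrow> x \<preceq> y\<^sup>\<star>"
proof -
  have "x \<bottom> y \<longleftrightarrow> y \<preceq> x\<^sup>\<star>"
    using join_commute[of y "x\<^sup>\<star>"] by (auto simp: orthogonal_def imp_eq_join lattice_le_def)
  also have "\<dots> \<longleftrightarrow> x \<preceq> y\<^sup>\<star>"
    using compl_le_compl_iff[of "x\<^sup>\<star>" y] by (simp add: involutive)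
  finally show ?thesis .
qed

lemma sasaki_eq: "sasaki a x = (x \<squnion> a\<^sup>\<star>) \<sqinter> a"
  by (simp add: sasaki_def meet_Q_def meet_def join_def involutive)

lemma compl_sasaki: "(sasaki a x)\<^sup>\<star> = (x\<^sup>\<star> \<sqinter> a) \<squnion> a\<^sup>\<star>"
  by (simp add: sasaki_eq compl_meet compl_join involutive)

text \<open>
  In the orthomodular identity \<open>y \<rightarrow> x = y\<^sup>\<star> \<squnion> x\<close> is an arbitrary element above \<open>x\<close>.
\<close>

lemma orthomodular_iff_sasaki_fixes_below:
  "implicative_orthomodular_lattice (\<rightarrow>) \<one> \<zero> \<longleftrightarrow> (\<forall>x y. x \<preceq> y \<longrightarrow> sasaki y x = x)"
proof
  assume "implicative_orthomodular_lattice (\<rightarrow>) \<one> \<zero>"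
  then interpret implicative_orthomodular_lattice "(\<rightarrow>)" \<one> \<zero> .
  show "\<forall>x y. x \<preceq> y \<longrightarrow> sasaki y x = x"
  proof (intro allI impI)
    fix x y assume "x \<preceq> y"
    then have "y\<^sup>\<star> \<rightarrow> x = y" by (simp add: imp_eq_join involutive join_commute[of y] lattice_le_def)
    then show "sasaki y x = x" using orthomodular[of x "y\<^sup>\<star>"] by (simp add: sasaki_def)
  qed
next
  assume fixes_below: "\<forall>x y. x \<preceq> y \<longrightarrow> sasaki y x = x"
  show "implicative_orthomodular_lattice (\<rightarrow>) \<one> \<zero>"
  proof unfold_locales
    fix x y
    have "x \<preceq> y \<rightarrow> x" by (simp add: imp_eq_join)
    then show "x \<and>\<^sub>Q (y \<rightarrow> x) = x" using fixes_below by (simp add: sasaki_def)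
  qed
qed

text \<open>
  This is the orthomodular law for \<open>y\<^sup>\<star> \<preceq> x \<squnion> y\<^sup>\<star>\<close>, in the dual form of the hypothesis: the
  complement of the left side is \<open>\<phi>\<^sub>y (x\<^sup>\<star> \<sqinter> y)\<close>, and \<open>x\<^sup>\<star> \<sqinter> y\<close> lies below \<open>y\<close>.
\<close>

lemma sasaki_join_compl:
  assumes "\<And>x y. x \<preceq> y \<Longrightarrow> sasaki y x = x"
  shows "sasaki y x \<squnion> y\<^sup>\<star> = x \<squnion> y\<^sup>\<star>"
proof -
  have "(sasaki y x \<squnion> y\<^sup>\<star>)\<^sup>\<star> = sasaki y (x\<^sup>\<star> \<sqinter> y)"
    by (simp add: sasaki_eq[of y "x\<^sup>\<star> \<sqinter> y"] compl_join compl_sasaki involutive)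
  also have "\<dots> = (x \<squnion> y\<^sup>\<star>)\<^sup>\<star>"
    using assms by (simp add: compl_join involutive)
  finally show ?thesis by (metis involutive)
qed

lemma orthomodular_iff_sasaki_self_adjoint:
  "implicative_orthomodular_lattice (\<rightarrow>) \<one> \<zero> \<longleftrightarrow>
    (\<forall>x y z. sasaki y x \<bottom> z \<longrightarrow> x \<bottom> sasaki y z)"
  unfolding orthomodular_iff_sasaki_fixes_below
proof (intro iffI allI impI)
  fix x y z
  assume fixes_below: "\<forall>x y. x \<preceq> y \<longrightarrow> sasaki y x = x" and "sasaki y x \<bottom> z"
  then have "sasaki y x \<preceq> z\<^sup>\<star> \<sqinter> y" by (simp add: orthogonal_iff sasaki_eq)
  then have "sasaki y x \<squnion> y\<^sup>\<star> \<preceq> (z\<^sup>\<star> \<sqinter> y) \<squnion> y\<^sup>\<star>" by (intro ortho.sup_mono ortho.order_refl)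
  then have "x \<squnion> y\<^sup>\<star> \<preceq> (sasaki y z)\<^sup>\<star>"
    using fixes_below by (simp add: sasaki_join_compl compl_sasaki)
  then show "x \<bottom> sasaki y z" by (simp add: orthogonal_iff)
next
  fix x y
  assume adjoint: "\<forall>x y z. sasaki y x \<bottom> z \<longrightarrow> x \<bottom> sasaki y z" and "x \<preceq> y"
  have "x\<^sup>\<star> \<squnion> y\<^sup>\<star> = x\<^sup>\<star>"
    using compl_antimono[OF \<open>x \<preceq> y\<close>] by (simp add: lattice_le_def join_commute[of "x\<^sup>\<star>"])
  then have "sasaki y (x\<^sup>\<star>) \<bottom> x" by (simp add: orthogonal_iff sasaki_eq)
  then have "x\<^sup>\<star> \<bottom> sasaki y x" using adjoint by blast
  then have "sasaki y x \<preceq> x" by (simp add: orthogonal_iff compl_le_compl_iff)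
  moreover have "x \<preceq> sasaki y x" using \<open>x \<preceq> y\<close> by (simp add: sasaki_eq)
  ultimately show "sasaki y x = x" by (rule ortho.order_antisym)
qed

end

theorem theorem4p5:
  fixes imp :: "'a \<Rightarrow> 'a \<Rightarrow> 'a" and one zero :: 'a
  assumes "implicative_ortholattice imp one zero"
  shows "implicative_orthomodular_lattice imp one zero \<longleftrightarrow>
    (\<forall>x y z.
      bounded_be_algebra.orthogonal imp zero (bounded_be_algebra.sasaki imp zero y x) z \<longrightarrow>
      bounded_be_algebra.orthogonal imp zero x (bounded_be_algebra.sasaki imp zero y z))"
proof -
  interpret implicative_ortholattice imp one zero by (rule assms)
  show ?thesis by (rule orthomodular_iff_sasaki_self_adjoint)
qed

end
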